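(* Let $\Pi_\mu$ be a prior (probability measure) on $C[0,1]$ with full sup-norm support, i.e. $\Pi_\mu(\|\mu-\mu^*\|_\infty<\epsilon)>0$ for every $\epsilon>0$ and every $\mu^*\in C[0,1]$, and let $\Pi_\sigma$ be a prior on $[0,\infty)$ with full support on $[0,\infty)$. Let $\Pi=(\Pi_\mu\otimes\Pi_\sigma)\circ f_{\mu,\sigma}^{-1}$ be the induced prior on the set $\mathcal F$ of probability densities on $\mathbb R$. Then the $L_1$ support of $\Pi$ contains all densities $f_0\in\mathcal F$ which have a finite first moment and are non-zero almost everywhere on their support; that is, for every such $f_0$ and every $\epsilon>0$, $\Pi(\{f\in\mathcal F:\|f-f_0\|_1<\epsilon\})>0$.
   Context: $\mathcal F$ is the set of all probability densities on $\mathbb R$ with respect to Lebesgue measure. $\phi_\sigma$ is the density of $N(0,\sigma^2)$. For $\mu\in C[0,1]$ and $\sigma>0$, $$f_{\mu,\sigma}(y)=\int_0^1\phi_\sigma(y-\mu(x))\,dx,\qquad y\in\mathbb R,$$ which is the marginal density of $Y=\mu(\eta)+\epsilon$ with $\eta\sim U(0,1)$ and $\epsilon\sim N(0,\sigma^2)$ independent. The induced prior $\Pi$ is the law of $f_{\mu,\sigma}$ when $\mu\sim\Pi_\mu$ and $\sigma\sim\Pi_\sigma$ independently. $\|\cdot\|_1$ is the $L_1$ norm with respect to Lebesgue measure on $\mathbb R$. *)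

theory Defs
  imports "HOL-Probability.Probability"
begin

text \<open>The metric space C[0,1] with the sup-norm distance. Its points are continuous functions on
  [0,1], represented by functions on the reals that are \<open>undefined\<close> outside [0,1].\<close>

definition C01 :: "(real \<Rightarrow> real) metric" where
  "C01 = cfunspace (top_of_set {0..1}) euclidean_metric"

lemma mspace_C01: "mspace C01 = {\<mu> \<in> extensional {0..1}. continuous_on {0..1} \<mu>}"
proof -
  have "Metric_space.mbounded UNIV dist (f ` {0..1})"
    if "continuous_on {0..1} f" for f :: "real \<Rightarrow> real"
  proof -
    have "bounded (f ` {0..1})"
      using that by (intro compact_imp_bounded compact_continuous_image) auto
    then show ?thesis
      by (metis mbounded_iff_bounded)
  qed
  then show ?thesis
    by (auto simp: C01_def Met_TC.fspace_def)
qed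

lemma mdist_C01:
  assumes "\<mu> \<in> mspace C01" "\<nu> \<in> mspace C01"
  shows "mdist C01 \<mu> \<nu> = (SUP x\<in>{0..1}. \<bar>\<mu> x - \<nu> x\<bar>)"
proof -
  have "\<mu> \<in> Met_TC.fspace {0..1}" "\<nu> \<in> Met_TC.fspace {0..1}"
    using assms unfolding C01_def
    by (metis (no_types) cfunspace_subset_funspace mdist_euclidean_metric mspace_euclidean_metric
      mspace_funspace subsetD topspace_euclidean_subtopology)+
  then show ?thesis
    by (simp add: C01_def mdist_cfunspace_eq_mdist_funspace Met_TC.fdist_def dist_real_def)
qed

definition borel_C01 :: "(real \<Rightarrow> real) measure" where
  "borel_C01 = sigma (mspace C01) {U. openin (mtopology_of C01) U}"

definition prob_densities :: "(real \<Rightarrow> real) set" where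
  "prob_densities = {f. integrable lborel f \<and> (\<forall>y. 0 \<le> f y) \<and> (LINT y|lborel. f y) = 1}"

definition L1_dist :: "(real \<Rightarrow> real) \<Rightarrow> (real \<Rightarrow> real) \<Rightarrow> real" where
  "L1_dist f g = (LINT y|lborel. \<bar>f y - g y\<bar>)"

text \<open>The Borel sigma-algebra of the (pseudo-)metric \<open>L1_dist\<close> on the set of densities. Densities
  are functions, not equivalence classes; an open set contains with a density all densities that
  are almost everywhere equal to it.\<close>

definition L1_open :: "(real \<Rightarrow> real) set \<Rightarrow> bool" where
  "L1_open U \<longleftrightarrow> U \<subseteq> prob_densities \<and>
     (\<forall>f\<in>U. \<exists>e>0. \<forall>g\<in>prob_densities. L1_dist g f < e \<longrightarrow> g \<in> U)"

definition borel_densities :: "(real \<Rightarrow> real) measure" where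
  "borel_densities = sigma prob_densities {U. L1_open U}"

definition mixture_density :: "(real \<Rightarrow> real) \<Rightarrow> real \<Rightarrow> real \<Rightarrow> real" where
  "mixture_density \<mu> \<sigma> y = (LBINT x:{0..1}. normal_density 0 \<sigma> (y - \<mu> x))"

text \<open>The law of the mixture density under the product prior. The mixture density is a
  density only for positive \<open>\<sigma>\<close>, whereas a prior on the half-line may charge the point 0; hence
  the product is restricted to positive \<open>\<sigma>\<close>. If the prior of \<open>\<sigma>\<close> gives no mass to 0, only a null
  set is discarded and the result is a probability measure.\<close>

definition induced_prior :: "(real \<Rightarrow> real) measure \<Rightarrow> real measure \<Rightarrow> (real \<Rightarrow> real) measure" where
  "induced_prior P Q =
     distr (restrict_space (P \<Otimes>\<^sub>M Q) (UNIV \<times> {0<..})) borel_densities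
       (\<lambda>(\<mu>, \<sigma>). mixture_density \<mu> \<sigma>)"

text \<open>The support of the distribution with density \<open>f\<close>, which unlike the closure of
  \<open>{x. f x \<noteq> 0}\<close> does not depend on the version of the density.\<close>

definition density_support :: "(real \<Rightarrow> real) \<Rightarrow> real set" where
  "density_support f = {x. \<forall>e>0. 0 < measure (density lborel f) (ball x e)}"

lemma density_support_subset:
  assumes "f \<in> prob_densities"
  shows "density_support f \<subseteq> closure {x. f x \<noteq> 0}"
proof
  fix x assume x: "x \<in> density_support f"
  have [measurable]: "f \<in> borel_measurable lborel"
    using assms by (auto simp: prob_densities_def)
  show "x \<in> closure {x. f x \<noteq> 0}"
  proof (rule ccontr)
    assume "x \<notin> closure {x. f x \<noteq> 0}"
    then obtain e where e: "e > 0" "\<And>y. dist y x < e \<Longrightarrow> f y = 0"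
      unfolding closure_approachable by auto
    have "emeasure (density lborel f) (ball x e)
        = (\<integral>\<^sup>+ y. ennreal (f y) * indicator (ball x e) y \<partial>lborel)"
      by (subst emeasure_density) auto
    also have "\<dots> = (\<integral>\<^sup>+ y. 0 \<partial>(lborel :: real measure))"
      using e(2) by (intro nn_integral_cong) (auto simp: indicator_def dist_commute)
    finally have "measure (density lborel f) (ball x e) = 0"
      by (simp add: measure_def)
    with x e(1) show False
      unfolding density_support_def by force
  qed
qed

end

theory Submission
  imports Defs
begin

text \<open>Two facts carry the result: the map \<open>(\<mu>, \<sigma>) \<mapsto> mixture_density \<mu> \<sigma>\<close> is continuous from
  \<open>C[0,1] \<times> (0, \<infinity>)\<close> to \<open>L\<^sup>1\<close>, and its range is dense among the densities. Given \<open>f0\<close>, density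
  (\<open>mixture_density_L1_dense\<close>) yields \<open>(m, s)\<close> whose mixture is close to \<open>f0\<close>, and continuity
  (\<open>mixture_density_continuous_L1\<close>) yields a product of a sup-norm ball around \<open>m\<close> and an interval
  around \<open>s\<close> that is mapped into the given \<open>L\<^sup>1\<close> ball around \<open>f0\<close>. Full support of the two priors
  makes both factors, and hence their product, positive.

  Everything about \<open>L\<^sup>1\<close> convergence of mixtures rests on Scheffe's lemma: for probability densities,
  pointwise convergence already implies convergence in \<open>L\<^sup>1\<close>. Pointwise convergence of mixtures
  is immediate from bounded convergence, since the Gaussian kernel is bounded as long as
  \<open>\<sigma>\<close> stays away from 0; almost everywhere convergence of \<open>\<mu>\<close> is enough
  (\<open>mixture_density_tendsto_L1\<close>).

  For density, \<open>f0\<close> is first approximated in \<open>L\<^sup>1\<close> by a bounded continuous density \<open>g\<close>. If \<open>q\<close> is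
  the quantile function of \<open>g\<close>, then \<open>q\<close> transports the uniform distribution to the law with
  density \<open>g\<close>, so the mixture with mean function \<open>q\<close> is exactly the convolution of \<open>g\<close> with the
  Gaussian kernel. For small \<open>\<sigma>\<close> this is close to \<open>g\<close>, because \<open>g\<close> is bounded and continuous.
  Finally \<open>q\<close>, which need not be continuous or bounded, is an almost everywhere limit of continuous
  functions, and these may replace it.

  The law of the mixture density is a push-forward, so the map must also be measurable with
  respect to the product of the two Borel sigma-algebras. An open subset of a product is a
  countable union of open rectangles as soon as one factor is second countable, and the \<open>\<sigma>\<close>-axis
  is (\<open>mixture_density_measurable\<close>).\<close>

section \<open>Mixture densities as integrals over the uniform distribution\<close>

abbreviation uniform01 :: "real measure" where
  "uniform01 \<equiv> restrict_space lborel {0..1}"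

lemma prob_space_uniform01: "prob_space uniform01"
  by (auto intro!: prob_spaceI simp: emeasure_restrict_space space_restrict_space)

interpretation uniform01: prob_space uniform01
  by (rule prob_space_uniform01)

lemma mixture_density_eq_integral_uniform01:
  "mixture_density \<mu> \<sigma> y = (LINT x|uniform01. normal_density 0 \<sigma> (y - \<mu> x))"
  by (simp add: mixture_density_def set_lebesgue_integral_def integral_restrict_space)

lemma continuous_on_imp_measurable_uniform01:
  assumes "continuous_on {0..1} \<mu>"
  shows "\<mu> \<in> borel_measurable uniform01"
proof -
  have "\<mu> \<in> borel_measurable (restrict_space borel {0..1})"
    using assms by (rule borel_measurable_continuous_on_restrict)
  then show ?thesis
    by (simp cong: measurable_cong_sets restrict_space_sets_cong)
qed

lemma measurable_C01: "\<mu> \<in> mspace C01 \<Longrightarrow> \<mu> \<in> borel_measurable uniform01"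
  by (simp add: mspace_C01 continuous_on_imp_measurable_uniform01)

text \<open>Fubini: for each fixed \<open>x\<close> the kernel is the normal density with mean \<open>\<mu> x\<close>. The mean function
  is merely measurable so that quantile functions are covered.\<close>

lemma mixture_density_in_prob_densities:
  assumes [measurable]: "\<mu> \<in> borel_measurable uniform01" and "0 < \<sigma>"
  shows "mixture_density \<mu> \<sigma> \<in> prob_densities"
proof -
  interpret pair_sigma_finite uniform01 "lborel :: real measure" ..
  have shift: "normal_density 0 \<sigma> (y - a) = normal_density a \<sigma> y" for a y
    by (simp add: normal_density_def)
  have int: "integrable (uniform01 \<Otimes>\<^sub>M lborel) (\<lambda>(x, y). normal_density 0 \<sigma> (y - \<mu> x))"
  proof (rule Fubini_integrable)
    show "integrable uniform01 (\<lambda>x. LINT y|lborel. norm (case (x, y) of (x, y) \<Rightarrow> normal_density 0 \<sigma> (y - \<mu> x)))"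
      using \<open>0 < \<sigma>\<close> by (simp add: shift)
    show "AE x in uniform01. integrable lborel (\<lambda>y. case (x, y) of (x, y) \<Rightarrow> normal_density 0 \<sigma> (y - \<mu> x))"
      using \<open>0 < \<sigma>\<close> by (simp add: shift)
  qed measurable
  have "integrable lborel (mixture_density \<mu> \<sigma>)"
    using integrable_snd[OF int] by (simp add: mixture_density_eq_integral_uniform01[abs_def])
  moreover have "0 \<le> mixture_density \<mu> \<sigma> y" for y
    by (simp add: mixture_density_eq_integral_uniform01)
  moreover have "(LINT y|lborel. mixture_density \<mu> \<sigma> y) = 1"
    using Fubini_integral[OF int] \<open>0 < \<sigma>\<close> uniform01.prob_space
    by (simp add: mixture_density_eq_integral_uniform01 shift)
  ultimately show ?thesis
    by (simp add: prob_densities_def)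
qed

section \<open>The L1 distance on densities\<close>

lemma L1_dist_triangle:
  assumes "integrable lborel f" "integrable lborel g" "integrable lborel h"
  shows "L1_dist f h \<le> L1_dist f g + L1_dist g h"
proof -
  have "L1_dist f h \<le> (LINT y|lborel. \<bar>f y - g y\<bar> + \<bar>g y - h y\<bar>)"
    unfolding L1_dist_def using assms by (intro integral_mono) auto
  also have "\<dots> = L1_dist f g + L1_dist g h"
    unfolding L1_dist_def using assms by (intro Bochner_Integration.integral_add) auto
  finally show ?thesis .
qed

lemma integrable_prob_density: "f \<in> prob_densities \<Longrightarrow> integrable lborel f"
  by (simp add: prob_densities_def)

lemma L1_open_ball: 
  assumes "f0 \<in> prob_densities"
  shows "L1_open {f \<in> prob_densities. L1_dist f f0 < \<epsilon>}"
  unfolding L1_open_def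
proof (intro conjI ballI)
  fix f assume f: "f \<in> {f \<in> prob_densities. L1_dist f f0 < \<epsilon>}"
  show "\<exists>e>0. \<forall>g\<in>prob_densities. L1_dist g f < e \<longrightarrow> g \<in> {f \<in> prob_densities. L1_dist f f0 < \<epsilon>}"
  proof (intro exI[of _ "\<epsilon> - L1_dist f f0"] conjI ballI impI)
    fix g assume g: "g \<in> prob_densities" "L1_dist g f < \<epsilon> - L1_dist f f0"
    have "L1_dist g f0 \<le> L1_dist g f + L1_dist f f0"
      using f g assms by (intro L1_dist_triangle integrable_prob_density) auto
    with g show "g \<in> {f \<in> prob_densities. L1_dist f f0 < \<epsilon>}" by simp
  qed (use f in simp)
qed auto

text \<open>Scheffe's lemma. Since all densities have norm 1, the required bound on the norms is automatic.\<close>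

lemma L1_dist_tendsto_0_if_pointwise:
  assumes F: "\<And>n. F n \<in> prob_densities" and f: "f \<in> prob_densities"
    and lim: "\<And>y. (\<lambda>n. F n y) \<longlonglongrightarrow> f y"
  shows "(\<lambda>n. L1_dist (F n) f) \<longlonglongrightarrow> 0"
proof -
  have nn: "(\<integral>\<^sup>+ y. norm (g y) \<partial>lborel) = 1" if "g \<in> prob_densities" for g
    using that by (auto simp: prob_densities_def nn_integral_eq_integral)
  have "(\<lambda>n. \<integral>\<^sup>+ y. norm (F n y - f y) \<partial>lborel) \<longlonglongrightarrow> 0"
    using F f lim by (intro Scheffe_lemma2)
      (simp_all only: nn integrable_prob_density borel_measurable_integrable AE_I2 order_refl)
  moreover have "(\<integral>\<^sup>+ y. norm (F n y - f y) \<partial>lborel) = ennreal (L1_dist (F n) f)" for n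
    using F[of n, THEN integrable_prob_density] f[THEN integrable_prob_density] unfolding L1_dist_def
    by (subst nn_integral_eq_integral) auto
  ultimately show ?thesis
    by (simp add: ennreal_tendsto_0_iff L1_dist_def)
qed

section \<open>Continuity of the mixture in the mean function and the standard deviation\<close>

lemma mixture_density_tendsto_L1:
  assumes [measurable]: "\<And>n. \<mu>s n \<in> borel_measurable uniform01" "\<mu> \<in> borel_measurable uniform01"
    and lim: "AE x in uniform01. (\<lambda>n. \<mu>s n x) \<longlonglongrightarrow> \<mu> x"
    and \<sigma>: "\<sigma>s \<longlonglongrightarrow> \<sigma>" "\<And>n. 0 < \<sigma>s n" "0 < \<sigma>"
  shows "(\<lambda>n. L1_dist (mixture_density (\<mu>s n) (\<sigma>s n)) (mixture_density \<mu> \<sigma>)) \<longlonglongrightarrow> 0"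
proof (rule L1_dist_tendsto_0_if_pointwise)
  fix y
  have "(\<lambda>n. 1 / sqrt (2 * pi * (\<sigma>s n)\<^sup>2)) \<longlonglongrightarrow> 1 / sqrt (2 * pi * \<sigma>\<^sup>2)"
    using \<sigma> by (intro tendsto_intros) auto
  then obtain K where K: "\<And>n. norm (1 / sqrt (2 * pi * (\<sigma>s n)\<^sup>2)) \<le> K"
    using convergent_imp_Bseq[OF convergentI] BseqE by metis
  \<comment> \<open>Any bound on the maximal values of the kernels dominates on the finite measure space \<open>[0,1]\<close>.\<close>
  have bound: "norm (normal_density 0 (\<sigma>s n) t) \<le> K" for n t
  proof -
    have "norm (normal_density 0 (\<sigma>s n) t) \<le> 1 / sqrt (2 * pi * (\<sigma>s n)\<^sup>2) * 1"
      unfolding real_norm_def abs_of_nonneg[OF normal_density_nonneg] unfolding normal_density_def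
      by (intro mult_left_mono) auto
    with K[of n] show ?thesis by simp
  qed
  show "(\<lambda>n. mixture_density (\<mu>s n) (\<sigma>s n) y) \<longlonglongrightarrow> mixture_density \<mu> \<sigma> y"
    unfolding mixture_density_eq_integral_uniform01
  proof (rule integral_dominated_convergence[where w = "\<lambda>_. K"])
    show "AE x in uniform01. (\<lambda>n. normal_density 0 (\<sigma>s n) (y - \<mu>s n x)) \<longlonglongrightarrow> normal_density 0 \<sigma> (y - \<mu> x)"
      using lim
    proof eventually_elim
      case (elim x)
      then show ?case
        using \<sigma> unfolding normal_density_def by (intro tendsto_intros) auto
    qed
  qed (use bound in auto)
qed (use \<sigma> in \<open>auto intro: mixture_density_in_prob_densities\<close>)

text \<open>Uniform convergence of mean functions is in particular pointwise, so the sequential statement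
  gives continuity with respect to the sup norm.\<close>

lemma mixture_density_continuous_L1:
  assumes \<mu>: "\<mu> \<in> mspace C01" and "0 < \<sigma>" "0 < \<epsilon>"
  obtains \<delta> where "0 < \<delta>" "\<And>\<nu> \<tau>. \<lbrakk>\<nu> \<in> mspace C01; 0 < \<tau>; mdist C01 \<nu> \<mu> < \<delta>; \<bar>\<tau> - \<sigma>\<bar> < \<delta>\<rbrakk>
    \<Longrightarrow> L1_dist (mixture_density \<nu> \<tau>) (mixture_density \<mu> \<sigma>) < \<epsilon>"
proof (rule ccontr)
  assume no_\<delta>: "\<not> thesis"
  note \<delta>I = that
  have "\<exists>\<nu> \<tau>. \<nu> \<in> mspace C01 \<and> 0 < \<tau> \<and> mdist C01 \<nu> \<mu> < \<delta> \<and> \<bar>\<tau> - \<sigma>\<bar> < \<delta> \<and>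
      \<not> L1_dist (mixture_density \<nu> \<tau>) (mixture_density \<mu> \<sigma>) < \<epsilon>" if "0 < \<delta>" for \<delta>
    using \<delta>I no_\<delta> that by metis
  then have "\<exists>\<nu> \<tau>. \<nu> \<in> mspace C01 \<and> 0 < \<tau> \<and> mdist C01 \<nu> \<mu> < 1 / Suc n \<and> \<bar>\<tau> - \<sigma>\<bar> < 1 / Suc n \<and>
      \<not> L1_dist (mixture_density \<nu> \<tau>) (mixture_density \<mu> \<sigma>) < \<epsilon>" for n
    by simp
  then obtain \<nu> \<tau> where \<nu>: "\<And>n. \<nu> n \<in> mspace C01" "\<And>n. mdist C01 (\<nu> n) \<mu> < 1 / Suc n"
    and \<tau>: "\<And>n. 0 < \<tau> n" "\<And>n. \<bar>\<tau> n - \<sigma>\<bar> < 1 / Suc n"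
    and far: "\<And>n. \<not> L1_dist (mixture_density (\<nu> n) (\<tau> n)) (mixture_density \<mu> \<sigma>) < \<epsilon>"
    by metis
  have null: "(\<lambda>n. 1 / real (Suc n)) \<longlonglongrightarrow> 0"
    using LIMSEQ_inverse_real_of_nat by (simp add: inverse_eq_divide)
  have "(\<lambda>n. \<tau> n - \<sigma>) \<longlonglongrightarrow> 0"
    by (intro Lim_null_comparison[OF _ null] always_eventually allI)
      (simp only: real_norm_def less_imp_le[OF \<tau>(2)])
  then have "\<tau> \<longlonglongrightarrow> \<sigma>"
    by (rule LIM_zero_cancel)
  moreover have "(\<lambda>n. \<nu> n x) \<longlonglongrightarrow> \<mu> x" if x: "x \<in> {0..1}" for x
  proof -
    have "\<bar>\<nu> n x - \<mu> x\<bar> \<le> mdist C01 (\<nu> n) \<mu>" for n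
    proof -
      have "dist (\<nu> n x) (\<mu> x) \<le> mdist C01 (\<nu> n) \<mu>"
        using mdist_cfunspace_imp_mdist_le[of "\<nu> n" "top_of_set {0..1}" euclidean_metric \<mu>] \<nu>(1) \<mu> x
        by (simp add: C01_def)
      then show ?thesis by (simp add: dist_real_def)
    qed
    then have "norm (\<nu> n x - \<mu> x) \<le> 1 / real (Suc n)" for n
      using \<nu>(2)[of n] by (smt (verit) real_norm_def)
    then have "(\<lambda>n. \<nu> n x - \<mu> x) \<longlonglongrightarrow> 0"
      by (intro Lim_null_comparison[OF _ null] always_eventually allI)
    then show ?thesis
      by (rule LIM_zero_cancel)
  qed
  then have "AE x in uniform01. (\<lambda>n. \<nu> n x) \<longlonglongrightarrow> \<mu> x"
    by (intro AE_I2) (simp add: space_restrict_space)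
  ultimately have "(\<lambda>n. L1_dist (mixture_density (\<nu> n) (\<tau> n)) (mixture_density \<mu> \<sigma>)) \<longlonglongrightarrow> 0"
    using \<nu>(1) \<tau>(1) \<mu> \<open>0 < \<sigma>\<close> by (intro mixture_density_tendsto_L1 measurable_C01)
  from order_tendstoD(2)[OF this \<open>0 < \<epsilon>\<close>] far show False
    by (auto simp: eventually_sequentially)
qed

section \<open>Joint measurability of the mixture\<close>

text \<open>A countable basis of the \<open>\<sigma>\<close>-axis makes the preimage of an open set \<open>W\<close> a countable union of
  measurable rectangles. For each basic set \<open>V\<close>, the union of all open sets of mean functions
  that together with \<open>V\<close> are mapped into \<open>W\<close> is again open, and by continuity the rectangles formed
  in this way exhaust the preimage of \<open>W\<close>.\<close>

lemma mixture_density_measurable: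
  assumes P: "sets P = sets borel_C01" and Q: "sets Q = sets (restrict_space borel {0..})"
  shows "(\<lambda>(\<mu>, \<sigma>). mixture_density \<mu> \<sigma>) \<in>
    restrict_space (P \<Otimes>\<^sub>M Q) (UNIV \<times> {0<..}) \<rightarrow>\<^sub>M borel_densities"
    (is "?F \<in> ?M \<rightarrow>\<^sub>M _")
  unfolding borel_densities_def
proof (rule measurable_measure_of)
  have spP: "space P = mspace C01"
    using sets_eq_imp_space_eq[OF P] by (simp add: borel_C01_def space_measure_of_conv)
  have spQ: "space Q = {0..}"
    using sets_eq_imp_space_eq[OF Q] by (simp add: space_restrict_space)
  have spM: "space ?M = mspace C01 \<times> {0<..}"
    by (auto simp: space_restrict_space space_pair_measure spP spQ)
  show "{U. L1_open U} \<subseteq> Pow prob_densities"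
    by (auto simp: L1_open_def)
  show F: "?F \<in> space ?M \<rightarrow> prob_densities"
    unfolding spM by (auto intro: mixture_density_in_prob_densities measurable_C01)
  have openP: "U \<in> sets P" if "openin (mtopology_of C01) U" for U
  proof -
    have "{U. openin (mtopology_of C01) U} \<subseteq> Pow (mspace C01)"
      by (auto dest!: openin_subset)
    then show ?thesis
      using that unfolding P borel_C01_def by (simp add: sets_measure_of)
  qed
  have openQ: "V \<inter> {0<..} \<in> sets Q" if "open V" for V :: "real set"
    unfolding Q sets_restrict_space by (rule image_eqI[of _ _ "V \<inter> {0<..}"]) (use that in auto)
  obtain \<B> :: "real set set" where \<B>: "countable \<B>" "topological_basis \<B>"
    using ex_countable_basis by auto
  show "?F -` W \<inter> space ?M \<in> sets ?M" if "W \<in> {U. L1_open U}" for W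
  proof -
    from that have W: "L1_open W" by simp
    \<comment> \<open>\<open>N V\<close> is the largest open set whose product with the positive part of \<open>V\<close> is mapped into \<open>W\<close>.\<close>
    define N where "N V = \<Union>{U. openin (mtopology_of C01) U \<and>
      (\<forall>\<mu>\<in>U. \<forall>\<sigma>\<in>V. 0 < \<sigma> \<longrightarrow> mixture_density \<mu> \<sigma> \<in> W)}" for V
    have N: "openin (mtopology_of C01) (N V)" for V
      unfolding N_def by auto
    have "?F -` W \<inter> space ?M = (\<Union>V\<in>\<B>. N V \<times> (V \<inter> {0<..}))"
    proof (intro equalityI subsetI)
      fix p assume "p \<in> ?F -` W \<inter> space ?M"
      then obtain \<mu> \<sigma> where p: "p = (\<mu>, \<sigma>)" "\<mu> \<in> mspace C01" "0 < \<sigma>" "mixture_density \<mu> \<sigma> \<in> W"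
        unfolding spM by auto
      obtain e where e: "e > 0" "\<And>g. g \<in> prob_densities \<Longrightarrow> L1_dist g (mixture_density \<mu> \<sigma>) < e \<Longrightarrow> g \<in> W"
        using W p unfolding L1_open_def by blast
      obtain \<delta> where \<delta>: "0 < \<delta>" "\<And>\<nu> \<tau>. \<lbrakk>\<nu> \<in> mspace C01; 0 < \<tau>; mdist C01 \<nu> \<mu> < \<delta>; \<bar>\<tau> - \<sigma>\<bar> < \<delta>\<rbrakk>
          \<Longrightarrow> L1_dist (mixture_density \<nu> \<tau>) (mixture_density \<mu> \<sigma>) < e"
        using mixture_density_continuous_L1[OF p(2,3) e(1)] by metis
      obtain V where V: "V \<in> \<B>" "\<sigma> \<in> V" "V \<subseteq> ball \<sigma> \<delta>"
        using topological_basisE[OF \<B>(2), of "ball \<sigma> \<delta>" \<sigma>] \<delta>(1) by auto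
      have "\<mu> \<in> mball_of C01 \<mu> \<delta>"
        using p \<delta>(1) by (simp add: mball_of_def Metric_space.centre_in_mball_iff)
      moreover have "openin (mtopology_of C01) (mball_of C01 \<mu> \<delta>)"
        by (simp add: mball_of_def mtopology_of_def Metric_space.openin_mball)
      moreover have "mixture_density \<nu> \<tau> \<in> W" if "\<nu> \<in> mball_of C01 \<mu> \<delta>" "\<tau> \<in> V" "0 < \<tau>" for \<nu> \<tau>
      proof -
        have "\<nu> \<in> mspace C01" "mdist C01 \<nu> \<mu> < \<delta>"
          using that(1) by (auto simp: in_mball_of mdist_commute)
        moreover have "\<bar>\<tau> - \<sigma>\<bar> < \<delta>"
          using V(3) that(2) by (auto simp: dist_real_def)
        ultimately show ?thesis
          using that(3) by (intro e(2) \<delta>(2) mixture_density_in_prob_densities measurable_C01)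
      qed
      ultimately have "\<mu> \<in> N V"
        unfolding N_def by blast
      with V p show "p \<in> (\<Union>V\<in>\<B>. N V \<times> (V \<inter> {0<..}))" by auto
    next
      fix p assume "p \<in> (\<Union>V\<in>\<B>. N V \<times> (V \<inter> {0<..}))"
      then obtain V \<mu> \<sigma> where p: "p = (\<mu>, \<sigma>)" "\<mu> \<in> N V" "\<sigma> \<in> V" "0 < \<sigma>" by auto
      have "\<mu> \<in> mspace C01"
        using openin_subset[OF N] p(2) by auto
      moreover have "mixture_density \<mu> \<sigma> \<in> W"
        using p unfolding N_def by blast
      ultimately show "p \<in> ?F -` W \<inter> space ?M"
        using p unfolding spM by auto
    qed
    also have "\<dots> \<in> sets (P \<Otimes>\<^sub>M Q)"
    proof (rule sets.countable_UN''[OF \<B>(1)])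
      show "N V \<times> (V \<inter> {0<..}) \<in> sets (P \<Otimes>\<^sub>M Q)" if "V \<in> \<B>" for V
        using openP[OF N] openQ[OF topological_basis_open[OF \<B>(2) that]] by (rule pair_measureI)
    qed
    finally have "?F -` W \<inter> space ?M \<in> sets (P \<Otimes>\<^sub>M Q)" .
    then show ?thesis
      unfolding sets_restrict_space
      by (rule image_eqI[rotated]) (auto simp: space_restrict_space)
  qed
qed

section \<open>Gaussian convolutions as mixtures\<close>

text \<open>The quantile function transports the uniform distribution to the law with density \<open>f\<close>; changing
  variables along it turns the mixture integral into a convolution integral.\<close>

lemma mixture_density_quantile:
  assumes f: "f \<in> prob_densities"
  obtains q where "q \<in> borel_measurable uniform01"
    "\<And>\<sigma> y. mixture_density q \<sigma> y = (LINT t|lborel. f t * normal_density 0 \<sigma> (y - t))"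
proof -
  let ?M = "density lborel f" and ?\<Omega> = "restrict_space lborel {0<..<1::real}"
  have fI: "integrable lborel f" "\<And>t. 0 \<le> f t" "(LINT t|lborel. f t) = 1"
    using f by (auto simp: prob_densities_def)
  then have [measurable]: "f \<in> borel_measurable borel"
    by auto
  interpret M: prob_space ?M
    by (rule prob_spaceI) (use fI in \<open>simp add: emeasure_density nn_integral_eq_integral\<close>)
  interpret M: cdf_distribution ?M
    by standard simp
  \<comment> \<open>The quantile function is meaningful on the open unit interval only; at the end points, a null
    set, it is given an arbitrary value.\<close>
  define q where "q = (\<lambda>x. if x \<in> {0<..<1} then M.I x else 0)"
  have meas_I [measurable]: "M.I \<in> borel_measurable ?\<Omega>"
    using M.measurable_CI by (simp cong: measurable_cong_sets restrict_space_sets_cong)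
  have meas_q [measurable]: "q \<in> borel_measurable borel"
    using M.measurable_CI unfolding q_def
    by (rule measurable_restrict_space_iff[where c = 0, THEN iffD1, rotated 2]) auto
  have "mixture_density q \<sigma> y = (LINT t|lborel. f t * normal_density 0 \<sigma> (y - t))" for \<sigma> y
  proof -
    have "mixture_density q \<sigma> y = (LINT x|lborel. indicator {0<..<1} x *\<^sub>R normal_density 0 \<sigma> (y - M.I x))"
      unfolding mixture_density_def set_lebesgue_integral_def
    proof (rule integral_cong_AE)
      show "AE x in lborel. indicator {0..1} x *\<^sub>R normal_density 0 \<sigma> (y - q x) =
          indicator {0<..<1} x *\<^sub>R normal_density 0 \<sigma> (y - M.I x)"
        using AE_lborel_singleton[of 0] AE_lborel_singleton[of "1::real"]
        by eventually_elim (auto simp: q_def indicator_def)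
      have "(\<lambda>x. indicator {0<..<1} x *\<^sub>R normal_density 0 \<sigma> (y - q x)) \<in> borel_measurable lborel"
        by measurable
      also have "(\<lambda>x. indicator {0<..<1} x *\<^sub>R normal_density 0 \<sigma> (y - q x)) =
          (\<lambda>x. indicator {0<..<1} x *\<^sub>R normal_density 0 \<sigma> (y - M.I x))"
        by (auto simp: q_def indicator_def)
      finally show "(\<lambda>x. indicator {0<..<1} x *\<^sub>R normal_density 0 \<sigma> (y - M.I x)) \<in> borel_measurable lborel" .
    qed measurable
    also have "\<dots> = (LINT x|?\<Omega>. normal_density 0 \<sigma> (y - M.I x))"
      by (simp add: integral_restrict_space)
    also have "\<dots> = (LINT t|distr ?\<Omega> borel M.I. normal_density 0 \<sigma> (y - t))"
      by (rule integral_distr[symmetric]) measurable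
    also have "\<dots> = (LINT t|lborel. f t * normal_density 0 \<sigma> (y - t))"
      unfolding M.distr_I_eq_M by (subst integral_density) (use fI in auto)
    finally show ?thesis .
  qed
  moreover have "q \<in> borel_measurable uniform01"
    by (simp add: measurable_restrict_space1)
  ultimately show thesis
    using that by blast
qed

text \<open>After the substitution \<open>t = y - s z\<close> the kernel no longer depends on \<open>s\<close>, and bounded convergence
  applies.\<close>

lemma gaussian_convolution_tendsto:
  fixes g :: "real \<Rightarrow> real"
  assumes cont: "continuous_on UNIV g" and bound: "\<And>t. \<bar>g t\<bar> \<le> K"
    and \<sigma>: "\<sigma>s \<longlonglongrightarrow> 0" "\<And>n. 0 < \<sigma>s n"
  shows "(\<lambda>n. LINT t|lborel. g t * normal_density 0 (\<sigma>s n) (y - t)) \<longlonglongrightarrow> g y"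
proof -
  have [measurable]: "g \<in> borel_measurable borel"
    using cont by (rule borel_measurable_continuous_onI)
  have "(LINT t|lborel. g t * normal_density 0 s (y - t)) =
      (LINT z|lborel. g (y + (- s) * z) * std_normal_density z)" if "0 < s" for s
  proof -
    have "s * normal_density 0 s (s * z) = std_normal_density z" for z
      using that unfolding normal_density_def
      by (simp add: real_sqrt_mult power_mult_distrib field_simps)
    then show ?thesis
      using that
      by (subst lborel_integral_real_affine[of "- s" _ y])
         (auto simp flip: integral_mult_right_zero intro!: Bochner_Integration.integral_cong
            simp: mult.left_commute)
  qed
  then have "(\<lambda>n. LINT t|lborel. g t * normal_density 0 (\<sigma>s n) (y - t)) =
      (\<lambda>n. LINT z|lborel. g (y + (- \<sigma>s n) * z) * std_normal_density z)"
    using \<sigma> by auto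
  also have "\<dots> \<longlonglongrightarrow> (LINT z|lborel. g y * std_normal_density z)"
  proof (rule integral_dominated_convergence[where w = "\<lambda>z. K * std_normal_density z"])
    show "AE z in lborel. (\<lambda>n. g (y + (- \<sigma>s n) * z) * std_normal_density z) \<longlonglongrightarrow> g y * std_normal_density z"
    proof (rule AE_I2)
      fix z
      have "(\<lambda>n. y + (- \<sigma>s n) * z) \<longlonglongrightarrow> y + (- 0) * z"
        using \<sigma> by (intro tendsto_intros)
      moreover have "isCont g y"
        using cont by (simp add: continuous_on_eq_continuous_at)
      ultimately have "(\<lambda>n. g (y + (- \<sigma>s n) * z)) \<longlonglongrightarrow> g y"
        by (intro isCont_tendsto_compose[of y g]) auto
      then show "(\<lambda>n. g (y + (- \<sigma>s n) * z) * std_normal_density z) \<longlonglongrightarrow> g y * std_normal_density z"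
        by (rule tendsto_mult_right)
    qed
    show "AE z in lborel. norm (g (y + (- \<sigma>s n) * z) * std_normal_density z) \<le> K * std_normal_density z" for n
      using bound by (intro AE_I2) (auto simp: abs_mult intro!: mult_right_mono)
  qed auto
  finally show ?thesis by simp
qed

section \<open>Approximation by continuous functions\<close>

lemma borel_measurable_ae_limit_of_continuous:
  fixes h :: "real \<Rightarrow> real"
  assumes h: "h \<in> borel_measurable (restrict_space lborel S)" and S: "S \<in> sets borel"
  obtains g where "\<And>n::nat. continuous_on UNIV (g n)"
    "AE x in lborel. x \<in> S \<longrightarrow> (\<lambda>n. g n x) \<longlonglongrightarrow> h x"
proof -
  have "(\<lambda>x. if x \<in> S then h x else 0) \<in> borel_measurable lborel"
    using h by (rule measurable_restrict_space_iff[where c = 0, THEN iffD1, rotated 2]) (use S in auto)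
  then have "(\<lambda>x. if x \<in> S then h x else 0) \<in> borel_measurable lebesgue"
    by (rule measurable_completion)
  then have "h \<in> borel_measurable (lebesgue_on S)"
    by (rule measurable_restrict_space_iff[where c = 0, THEN iffD2, rotated 2]) (use S in auto)
  then have "h measurable_on S"
    using S by (subst measurable_on_iff_borel_measurable) auto
  then obtain N g where N: "negligible N" and g: "\<And>n::nat. continuous_on UNIV (g n)"
    "\<And>x. x \<notin> N \<Longrightarrow> (\<lambda>n. g n x) \<longlonglongrightarrow> (if x \<in> S then h x else 0)"
    unfolding measurable_on_def by metis
  have "AE x in lebesgue. x \<notin> N"
    using N by (intro AE_not_in) (simp add: negligible_iff_null_sets)
  then have "AE x in lborel. x \<notin> N"
    by (simp add: AE_completion_iff)
  then have "AE x in lborel. x \<in> S \<longrightarrow> (\<lambda>n. g n x) \<longlonglongrightarrow> h x"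
    by eventually_elim (use g(2) in force)
  with g(1) that show thesis by blast
qed

text \<open>Almost everywhere approximation by continuous functions \<open>h n\<close> gives no control of integrals. A
  large multiple \<open>w K\<close> of the standard normal density therefore serves as a continuous integrable
  cap: \<open>min f (w K)\<close> is close to \<open>f\<close> for large \<open>K\<close>, and the functions \<open>h n\<close>, clipped between 0 and
  \<open>w K\<close>, stay continuous and converge to \<open>min f (w K)\<close> by dominated convergence. Clipping changes
  the total mass only slightly, which is repaired by normalisation.\<close>

lemma L1_approx_bounded_continuous_density:
  assumes f: "f \<in> prob_densities" and "0 < \<epsilon>"
  obtains g K where "g \<in> prob_densities" "continuous_on UNIV g" "\<And>y. \<bar>g y\<bar> \<le> K" "L1_dist g f < \<epsilon>"
proof -
  \<comment> \<open>The clipped function has distance at most \<open>e\<close> from \<open>f\<close>, and normalisation costs at most another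
    \<open>e\<close>. Taking \<open>e < 1\<close> keeps the mass positive.\<close>
  define e where "e = min (\<epsilon> / 2) (1 / 2)"
  have e: "0 < e" "e < 1" "e + e \<le> \<epsilon>"
    using \<open>0 < \<epsilon>\<close> by (auto simp: e_def)
  have f0: "\<And>y. 0 \<le> f y" "integrable lborel f" "(LINT y|lborel. f y) = 1"
    using f by (auto simp: prob_densities_def)
  then have fm[measurable]: "f \<in> borel_measurable borel" by auto
  define w where "w K y = real K * std_normal_density y" for K y
  have [measurable]: "w K \<in> borel_measurable borel" for K
    unfolding w_def by measurable
  have w: "0 \<le> w K y" "integrable lborel (w K)" "continuous_on UNIV (w K)" "w K y \<le> K" for K y
  proof -
    show "continuous_on UNIV (w K)"
      unfolding w_def std_normal_density_def by (intro continuous_intros) auto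
    have "sqrt (2 * pi) \<ge> 1" using pi_ge_two by auto
    then have "1 / sqrt (2 * pi) * exp (- y\<^sup>2 / 2) \<le> 1 * 1" by (intro mult_mono) auto
    from mult_left_mono[OF this, of "real K"] show "w K y \<le> K"
      unfolding w_def std_normal_density_def by simp
    show "integrable lborel (w K)"
      unfolding w_def[abs_def] by simp
  qed (auto simp: w_def)
  have "(\<lambda>K. LINT y|lborel. \<bar>min (f y) (w K y) - f y\<bar>) \<longlonglongrightarrow> (LINT y|(lborel :: real measure). 0)"
  proof (rule integral_dominated_convergence[where w = f])
    show "AE y in lborel. (\<lambda>K. \<bar>min (f y) (w K y) - f y\<bar>) \<longlonglongrightarrow> 0"
    proof (rule AE_I2)
      fix y
      have "filterlim (\<lambda>K. w K y) at_top sequentially"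
        unfolding w_def using normal_density_pos[of 1 0 y]
        by (intro filterlim_at_top_mult_tendsto_pos[OF tendsto_const _ filterlim_real_sequentially]) auto
      then have "\<forall>\<^sub>F K in sequentially. f y \<le> w K y"
        by (simp add: filterlim_at_top)
      then have "\<forall>\<^sub>F K in sequentially. \<bar>min (f y) (w K y) - f y\<bar> = 0"
        by eventually_elim auto
      then show "(\<lambda>K. \<bar>min (f y) (w K y) - f y\<bar>) \<longlonglongrightarrow> 0"
        by (rule tendsto_eventually)
    qed
    show "AE y in lborel. norm \<bar>min (f y) (w K y) - f y\<bar> \<le> f y" for K
      using f0 w by (intro AE_I2) (auto simp: min_def)
  qed (use f0 in auto)
  then have "\<forall>\<^sub>F K in sequentially. (LINT y|lborel. \<bar>min (f y) (w K y) - f y\<bar>) < e / 2"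
    using e by (intro order_tendstoD) auto
  then obtain K where K: "L1_dist (\<lambda>y. min (f y) (w K y)) f < e / 2"
    unfolding L1_dist_def by (auto simp: eventually_sequentially)
  have "f \<in> borel_measurable (restrict_space lborel UNIV)"
    using fm by (simp add: measurable_restrict_space1)
  then obtain h where h: "\<And>n::nat. continuous_on UNIV (h n)" "AE x in lborel. (\<lambda>n. h n x) \<longlonglongrightarrow> f x"
    by (rule borel_measurable_ae_limit_of_continuous) auto
  have [measurable]: "h n \<in> borel_measurable borel" for n
    using h(1) by (rule borel_measurable_continuous_onI)
  define G where "G n y = min (max (h n y) 0) (w K y)" for n y
  have [measurable]: "G n \<in> borel_measurable borel" for n
    unfolding G_def by measurable
  have G: "0 \<le> G n y" "G n y \<le> w K y" "continuous_on UNIV (G n)" "integrable lborel (G n)" for n y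
  proof -
    show G1: "0 \<le> G n y" "G n y \<le> w K y" for y
      by (auto simp: G_def w)
    show "continuous_on UNIV (G n)"
      unfolding G_def[abs_def] by (intro continuous_intros h w)
    show "integrable lborel (G n)"
      by (rule Bochner_Integration.integrable_bound[OF w(2)[of K]]) (use G1 in \<open>auto simp: w\<close>)
  qed
  have "(\<lambda>n. LINT y|lborel. \<bar>G n y - min (f y) (w K y)\<bar>) \<longlonglongrightarrow> (LINT y|(lborel :: real measure). 0)"
  proof (rule integral_dominated_convergence[where w = "w K"])
    show "AE y in lborel. (\<lambda>n. \<bar>G n y - min (f y) (w K y)\<bar>) \<longlonglongrightarrow> 0"
      using h(2)
    proof eventually_elim
      case (elim y)
      have "(\<lambda>n. \<bar>G n y - min (f y) (w K y)\<bar>) \<longlonglongrightarrow> \<bar>min (max (f y) 0) (w K y) - min (f y) (w K y)\<bar>"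
        unfolding G_def by (intro tendsto_intros elim)
      then show ?case using f0(1)[of y] by (simp add: max_def)
    qed
    show "AE y in lborel. norm \<bar>G n y - min (f y) (w K y)\<bar> \<le> w K y" for n
      using f0(1) w(1) G(1,2)[of n] by (intro AE_I2) (auto simp: min_def abs_le_iff; smt (verit))
  qed (use w in auto)
  then have "\<forall>\<^sub>F n in sequentially. (LINT y|lborel. \<bar>G n y - min (f y) (w K y)\<bar>) < e / 2"
    using e by (intro order_tendstoD) auto
  then obtain n where n: "L1_dist (G n) (\<lambda>y. min (f y) (w K y)) < e / 2"
    unfolding L1_dist_def by (auto simp: eventually_sequentially)
  have close: "L1_dist (G n) f < e"
    using L1_dist_triangle[of "G n" "\<lambda>y. min (f y) (w K y)" f] K n G(4) w(2) f0(2) by auto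
  define c where "c = (LINT y|lborel. G n y)"
  have "\<bar>c - 1\<bar> = \<bar>LINT y|lborel. G n y - f y\<bar>"
    unfolding c_def using G(4) f0 by (subst Bochner_Integration.integral_diff) auto
  also have "\<dots> \<le> L1_dist (G n) f"
    unfolding L1_dist_def by (rule integral_abs_bound)
  finally have c: "\<bar>c - 1\<bar> < e" "0 < c"
    using close e by auto
  show thesis
  proof (rule that)
    show "(\<lambda>y. G n y / c) \<in> prob_densities"
      using G c by (simp add: prob_densities_def) (simp add: c_def)
    show "continuous_on UNIV (\<lambda>y. G n y / c)"
      using G c by (intro continuous_intros) auto
    show "\<bar>G n y / c\<bar> \<le> real K / c" for y
      using G(1)[of n y] order_trans[OF G(2)[of n y] w(4)] c by (simp add: divide_right_mono)
    have "L1_dist (\<lambda>y. G n y / c) (G n) = (LINT y|lborel. G n y * (\<bar>1 - c\<bar> / c))"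
      unfolding L1_dist_def
    proof (rule Bochner_Integration.integral_cong)
      fix y
      have "G n y / c - G n y = G n y * ((1 - c) / c)"
        using c by (simp add: field_simps)
      then show "\<bar>G n y / c - G n y\<bar> = G n y * (\<bar>1 - c\<bar> / c)"
        using c G(1)[of n y] by (simp add: abs_mult)
    qed simp
    also have "\<dots> = \<bar>1 - c\<bar>"
      using c by (simp add: c_def)
    finally have "L1_dist (\<lambda>y. G n y / c) (G n) < e"
      using c by auto
    then show "L1_dist (\<lambda>y. G n y / c) f < \<epsilon>"
      using L1_dist_triangle[of "\<lambda>y. G n y / c" "G n" f] close G(4) f0(2) e by auto
  qed
qed

section \<open>Density of the mixtures and the support of the induced prior\<close>

text \<open>Three approximations, each costing a third of \<open>\<epsilon>\<close>: \<open>f\<close> by a bounded continuous density \<open>g\<close>, then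
  \<open>g\<close> by its convolution with a narrow Gaussian kernel, which is the mixture along the quantile
  function \<open>q\<close>, and finally \<open>q\<close> by a continuous mean function.\<close>

lemma mixture_density_L1_dense:
  assumes f: "f \<in> prob_densities" and "0 < \<epsilon>"
  obtains \<mu> \<sigma> where "\<mu> \<in> mspace C01" "0 < \<sigma>" "L1_dist (mixture_density \<mu> \<sigma>) f < \<epsilon>"
proof -
  have \<epsilon>3: "0 < \<epsilon> / 3" using \<open>0 < \<epsilon>\<close> by simp
  obtain g K where g: "g \<in> prob_densities" "continuous_on UNIV g" "\<And>y. \<bar>g y\<bar> \<le> K" "L1_dist g f < \<epsilon> / 3"
    by (rule L1_approx_bounded_continuous_density[OF f \<epsilon>3]) blast
  obtain q where q: "q \<in> borel_measurable uniform01"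
    "\<And>\<sigma> y. mixture_density q \<sigma> y = (LINT t|lborel. g t * normal_density 0 \<sigma> (y - t))"
    by (rule mixture_density_quantile[OF g(1)]) blast
  have "(\<lambda>n. L1_dist (mixture_density q (1 / real (Suc n))) g) \<longlonglongrightarrow> 0"
  proof (rule L1_dist_tendsto_0_if_pointwise)
    show "(\<lambda>n. mixture_density q (1 / real (Suc n)) y) \<longlonglongrightarrow> g y" for y
      unfolding q(2)
    proof (rule gaussian_convolution_tendsto[OF g(2,3)])
      show "(\<lambda>n. 1 / real (Suc n)) \<longlonglongrightarrow> 0"
        using LIMSEQ_inverse_real_of_nat by (simp add: inverse_eq_divide)
    qed simp
  qed (use g q in \<open>auto intro: mixture_density_in_prob_densities\<close>)
  from order_tendstoD(2)[OF this \<epsilon>3]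
  obtain m where m: "L1_dist (mixture_density q (1 / real (Suc m))) g < \<epsilon> / 3"
    by (auto simp: eventually_sequentially)
  define \<sigma> where "\<sigma> = 1 / real (Suc m)"
  have \<sigma>: "0 < \<sigma>" by (simp add: \<sigma>_def)
  obtain h where h: "\<And>n::nat. continuous_on UNIV (h n)" "AE x in lborel. x \<in> {0..1} \<longrightarrow> (\<lambda>n. h n x) \<longlonglongrightarrow> q x"
    by (rule borel_measurable_ae_limit_of_continuous[OF q(1)]) auto
  define \<mu> where "\<mu> n = restrict (h n) {0..1}" for n
  have \<mu>: "\<mu> n \<in> mspace C01" for n
    using continuous_on_subset[OF h(1)]
    by (auto simp: \<mu>_def mspace_C01 intro: continuous_on_eq[of "{0..1}" "h n"])
  have "AE x in uniform01. (\<lambda>n. \<mu> n x) \<longlonglongrightarrow> q x"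
    using h(2) by (subst AE_restrict_space_iff) (auto simp: \<mu>_def elim!: eventually_mono)
  then have "(\<lambda>n. L1_dist (mixture_density (\<mu> n) \<sigma>) (mixture_density q \<sigma>)) \<longlonglongrightarrow> 0"
    using q(1) measurable_C01[OF \<mu>] \<sigma> by (intro mixture_density_tendsto_L1) auto
  from order_tendstoD(2)[OF this \<epsilon>3]
  obtain n where n: "L1_dist (mixture_density (\<mu> n) \<sigma>) (mixture_density q \<sigma>) < \<epsilon> / 3"
    by (auto simp: eventually_sequentially)
  have int: "integrable lborel (mixture_density (\<mu> n) \<sigma>)" "integrable lborel (mixture_density q \<sigma>)"
      "integrable lborel g" "integrable lborel f"
    using f g q \<mu> \<sigma> by (auto intro!: integrable_prob_density mixture_density_in_prob_densities measurable_C01)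
  have "L1_dist (mixture_density (\<mu> n) \<sigma>) f < \<epsilon>"
    using L1_dist_triangle[OF int(1,2,4)] L1_dist_triangle[OF int(2,3,4)] n m g(4)
    unfolding \<sigma>_def[symmetric] by linarith
  then show thesis
    using that \<mu> \<sigma> by blast
qed

theorem theorem3p1:
  fixes \<Pi>\<^sub>\<mu> :: "(real \<Rightarrow> real) measure" and \<Pi>\<^sub>\<sigma> :: "real measure" and f0 :: "real \<Rightarrow> real"
  assumes "prob_space \<Pi>\<^sub>\<mu>" and "sets \<Pi>\<^sub>\<mu> = sets borel_C01"
    and full_\<mu>: "\<And>\<mu>' \<epsilon>. \<lbrakk>\<mu>' \<in> mspace C01; 0 < \<epsilon>\<rbrakk> \<Longrightarrow>
          0 < measure \<Pi>\<^sub>\<mu> {\<mu> \<in> mspace C01. mdist C01 \<mu> \<mu>' < \<epsilon>}"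
    and "prob_space \<Pi>\<^sub>\<sigma>" and "sets \<Pi>\<^sub>\<sigma> = sets (restrict_space borel {0..})"
    and full_\<sigma>: "\<And>\<sigma>' \<epsilon>. \<lbrakk>0 \<le> \<sigma>'; 0 < \<epsilon>\<rbrakk> \<Longrightarrow>
          0 < measure \<Pi>\<^sub>\<sigma> {\<sigma> \<in> {0..}. \<bar>\<sigma> - \<sigma>'\<bar> < \<epsilon>}"
    and "f0 \<in> prob_densities"
    and first_moment: "integrable lborel (\<lambda>y. \<bar>y\<bar> * f0 y)"
    and nonzero: "AE y in lborel. y \<in> density_support f0 \<longrightarrow> f0 y \<noteq> 0"
  shows "\<forall>\<epsilon>>0. 0 < measure (induced_prior \<Pi>\<^sub>\<mu> \<Pi>\<^sub>\<sigma>) {f \<in> prob_densities. L1_dist f f0 < \<epsilon>}"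
proof (intro allI impI)
  fix \<epsilon> :: real assume "0 < \<epsilon>"
  then have "0 < \<epsilon> / 2" by simp
  interpret \<mu>: prob_space \<Pi>\<^sub>\<mu> by fact
  interpret \<sigma>: prob_space \<Pi>\<^sub>\<sigma> by fact
  interpret P: pair_prob_space \<Pi>\<^sub>\<mu> \<Pi>\<^sub>\<sigma> ..
  let ?U = "{f \<in> prob_densities. L1_dist f f0 < \<epsilon>}"
  let ?R = "restrict_space (\<Pi>\<^sub>\<mu> \<Otimes>\<^sub>M \<Pi>\<^sub>\<sigma>) (UNIV \<times> {0<..})"
  let ?F = "\<lambda>(\<mu>, \<sigma>). mixture_density \<mu> \<sigma>"
  obtain m s where m: "m \<in> mspace C01" and s: "0 < s" and near: "L1_dist (mixture_density m s) f0 < \<epsilon> / 2"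
    by (rule mixture_density_L1_dense[OF \<open>f0 \<in> prob_densities\<close> \<open>0 < \<epsilon> / 2\<close>])
  obtain \<delta> where \<delta>: "0 < \<delta>" "\<And>\<nu> \<tau>. \<lbrakk>\<nu> \<in> mspace C01; 0 < \<tau>; mdist C01 \<nu> m < \<delta>; \<bar>\<tau> - s\<bar> < \<delta>\<rbrakk>
      \<Longrightarrow> L1_dist (mixture_density \<nu> \<tau>) (mixture_density m s) < \<epsilon> / 2"
    using mixture_density_continuous_L1[OF m s \<open>0 < \<epsilon> / 2\<close>] by metis
  \<comment> \<open>The radius \<open>min \<delta> s\<close> keeps the interval away from 0, where the product is cut off.\<close>
  let ?A = "{\<nu> \<in> mspace C01. mdist C01 \<nu> m < \<delta>}" and ?B = "{\<tau> \<in> {0..}. \<bar>\<tau> - s\<bar> < min \<delta> s}"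
  have A: "0 < measure \<Pi>\<^sub>\<mu> ?A" and B: "0 < measure \<Pi>\<^sub>\<sigma> ?B"
    using full_\<mu>[OF m \<delta>(1)] full_\<sigma>[of s "min \<delta> s"] s \<delta>(1) by auto
  have sets: "?A \<in> sets \<Pi>\<^sub>\<mu>" "?B \<in> sets \<Pi>\<^sub>\<sigma>"
    using A B measure_notin_sets by fastforce+
  have sp: "space \<Pi>\<^sub>\<mu> = mspace C01" "space \<Pi>\<^sub>\<sigma> = {0..}"
    using sets_eq_imp_space_eq[OF assms(2)] sets_eq_imp_space_eq[OF assms(5)]
    by (simp_all add: borel_C01_def space_measure_of_conv space_restrict_space)
  have sub: "?A \<times> ?B \<subseteq> ?F -` ?U \<inter> space ?R"
  proof
    fix p assume "p \<in> ?A \<times> ?B"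
    then obtain \<nu> \<tau> where p: "p = (\<nu>, \<tau>)" "\<nu> \<in> mspace C01" "mdist C01 \<nu> m < \<delta>" "\<bar>\<tau> - s\<bar> < \<delta>" "0 < \<tau>"
      by auto
    have "mixture_density \<nu> \<tau> \<in> prob_densities" "mixture_density m s \<in> prob_densities"
      using p m s by (auto intro: mixture_density_in_prob_densities measurable_C01)
    moreover from this have "L1_dist (mixture_density \<nu> \<tau>) f0 < \<epsilon>"
      using L1_dist_triangle[of "mixture_density \<nu> \<tau>" "mixture_density m s" f0] \<delta>(2)[of \<nu> \<tau>] p near
        \<open>f0 \<in> prob_densities\<close> integrable_prob_density by force
    ultimately show "p \<in> ?F -` ?U \<inter> space ?R"
      using p by (auto simp: space_restrict_space space_pair_measure sp)
  qed
  note F = mixture_density_measurable[OF assms(2) assms(5)]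
  have "{U. L1_open U} \<subseteq> Pow prob_densities"
    by (auto simp: L1_open_def)
  then have U: "?U \<in> sets borel_densities"
    unfolding borel_densities_def using L1_open_ball[OF \<open>f0 \<in> prob_densities\<close>]
    by (simp add: sets_measure_of)
  have pos: "space \<Pi>\<^sub>\<mu> \<times> {0<..} \<in> sets (\<Pi>\<^sub>\<mu> \<Otimes>\<^sub>M \<Pi>\<^sub>\<sigma>)"
    by (intro pair_measureI sets.top)
      (auto simp: assms(5) sets_restrict_space intro!: image_eqI[of _ _ "{0<..}"])
  then have \<Omega>: "(UNIV \<times> {0<..}) \<inter> space (\<Pi>\<^sub>\<mu> \<Otimes>\<^sub>M \<Pi>\<^sub>\<sigma>) \<in> sets (\<Pi>\<^sub>\<mu> \<Otimes>\<^sub>M \<Pi>\<^sub>\<sigma>)"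
    by (rule back_subst[of "\<lambda>X. X \<in> _"]) (auto simp: space_pair_measure sp)
  have "0 < measure \<Pi>\<^sub>\<mu> ?A * measure \<Pi>\<^sub>\<sigma> ?B"
    using A B by simp
  also have "\<dots> = measure (\<Pi>\<^sub>\<mu> \<Otimes>\<^sub>M \<Pi>\<^sub>\<sigma>) (?A \<times> ?B)"
    using sets by (simp add: \<sigma>.emeasure_pair_measure_Times measure_def enn2real_mult)
  also have "\<dots> \<le> measure (\<Pi>\<^sub>\<mu> \<Otimes>\<^sub>M \<Pi>\<^sub>\<sigma>) (?F -` ?U \<inter> space ?R)"
    using sub measurable_sets[OF F U] \<Omega>
    by (intro P.finite_measure_mono) (auto simp: sets_restrict_space_iff)
  also have "\<dots> = measure ?R (?F -` ?U \<inter> space ?R)"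
    using \<Omega> by (intro measure_restrict_space[symmetric]) (auto simp: space_restrict_space)
  also have "\<dots> = measure (induced_prior \<Pi>\<^sub>\<mu> \<Pi>\<^sub>\<sigma>) ?U"
    unfolding induced_prior_def by (rule measure_distr[OF F U, symmetric])
  finally show "0 < measure (induced_prior \<Pi>\<^sub>\<mu> \<Pi>\<^sub>\<sigma>) ?U" .
qed

end
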